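(* Let $K,M\in\mathbb{R}^{n\times n}$ with $K$ symmetric positive semi-definite and $M$ symmetric positive definite, let $H=\begin{bmatrix} O & K \\ M & O\end{bmatrix}$ with $\dim(\mathcal{N}(H))=r>0$, and let $\mathbb{R}^{2n}=\mathcal{V}_0\oplus\mathcal{V}_1\oplus\cdots\oplus\mathcal{V}_{n-r}$ be a direct sum decomposition into biorthogonal invariant subspaces of $H$ of the form described in the context, with $0<\lambda_1\le\cdots\le\lambda_{n-r}$ all the positive eigenvalues of $H$ (listed with multiplicity). Then for any given $k\in\{1,\dots,n-r\}$ and $\ell\in\{0,1,\dots,n-r-k\}$, $$\sum_{i=1}^k\lambda_{\ell+i}=\min\ \frac12\,\mathrm{trace}\big(U^{\top}KU+V^{\top}MV\big),$$ where the minimum is taken over all $U,V\in\mathbb{R}^{n\times k}$ such that $U^{\top}V=I_k$ and $\begin{bmatrix}V \\ U\end{bmatrix}$ is biorthogonal to $\mathcal{V}_0\oplus\cdots\oplus\mathcal{V}_\ell$.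
   Context: $\mathcal{N}(\cdot)$ denotes the nullspace of a matrix, $O$ a zero matrix, $\mathbf{0}$ a zero vector, and $I_m$ the $m\times m$ identity matrix. Vectors of $\mathbb{R}^{2n}$ are written in block form $\begin{bmatrix}y \\ x\end{bmatrix}$ with $x,y\in\mathbb{R}^n$. Biorthogonality: two vectors $\begin{bmatrix}y \\ x\end{bmatrix}$ and $\begin{bmatrix}z \\ w\end{bmatrix}$ of $\mathbb{R}^{2n}$ (with $x,y,z,w\in\mathbb{R}^n$) are biorthogonal to each other if $y^{\top}w=z^{\top}x=0$. A vector is biorthogonal to a subspace $\mathcal{V}\subset\mathbb{R}^{2n}$ if it is biorthogonal to every element of $\mathcal{V}$. A matrix $\begin{bmatrix}V \\ U\end{bmatrix}\in\mathbb{R}^{2n\times k}$ (with $U,V\in\mathbb{R}^{n\times k}$) is biorthogonal to a subspace $\mathcal{V}$ if each of its columns is biorthogonal to $\mathcal{V}$. Two subspaces are biorthogonal if every element of one is biorthogonal to every element of the other. The decomposition: there are vectors $x_1^0,\dots,x_r^0,\,y_1^0,\dots,y_r^0,\,x_1,\dots,x_{n-r},\,y_1,\dots,y_{n-r}\in\mathbb{R}^n$ such that $$\mathcal{V}_0=\mathrm{span}\left\{\begin{bmatrix}\mathbf{0} \\ x_1^0\end{bmatrix},\dots,\begin{bmatrix}\mathbf{0} \\ x_r^0\end{bmatrix},\begin{bmatrix}y_1^0 \\ \mathbf{0}\end{bmatrix},\dots,\begin{bmatrix}y_r^0 \\ \mathbf{0}\end{bmatrix}\right\},\qquad \mathcal{V}_i=\mathrm{span}\left\{\begin{bmatrix}\mathbf{0}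 \\ x_i\end{bmatrix},\begin{bmatrix}y_i \\ \mathbf{0}\end{bmatrix}\right\}\ (i=1,\dots,n-r),$$ $$H\begin{bmatrix}\mathbf{0} \\ x_i^0\end{bmatrix}=\begin{bmatrix}\mathbf{0} \\ \mathbf{0}\end{bmatrix},\quad H\begin{bmatrix}y_i^0 \\ \mathbf{0}\end{bmatrix}=\begin{bmatrix}\mathbf{0} \\ x_i^0\end{bmatrix}\ (i=1,\dots,r),$$ $$H\begin{bmatrix}y_i \\ x_i\end{bmatrix}=\lambda_i\begin{bmatrix}y_i \\ x_i\end{bmatrix},\quad H\begin{bmatrix}-y_i \\ x_i\end{bmatrix}=-\lambda_i\begin{bmatrix}-y_i \\ x_i\end{bmatrix}\ (i=1,\dots,n-r),$$ and $$[x_1^0,\dots,x_r^0,x_1,\dots,x_{n-r}]^{\top}[y_1^0,\dots,y_r^0,y_1,\dots,y_{n-r}]=I_n .$$ *)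

theory Defs
  imports
    "Jordan_Normal_Form.Matrix_Kernel"
    "Jordan_Normal_Form.Char_Poly"
begin

definition pos_semidef_mat :: "nat \<Rightarrow> real mat \<Rightarrow> bool" where
  "pos_semidef_mat n A \<longleftrightarrow> A \<in> carrier_mat n n \<and> A\<^sup>T = A \<and>
     (\<forall>v \<in> carrier_vec n. 0 \<le> v \<bullet> (A *\<^sub>v v))"

definition pos_def_mat :: "nat \<Rightarrow> real mat \<Rightarrow> bool" where
  "pos_def_mat n A \<longleftrightarrow> A \<in> carrier_mat n n \<and> A\<^sup>T = A \<and>
     (\<forall>v \<in> carrier_vec n. v \<noteq> 0\<^sub>v n \<longrightarrow> 0 < v \<bullet> (A *\<^sub>v v))"

definition mat_trace :: "'a :: comm_monoid_add mat \<Rightarrow> 'a" where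
  "mat_trace A = (\<Sum>i<dim_row A. A $$ (i, i))"

definition lr_mat :: "nat \<Rightarrow> real mat \<Rightarrow> real mat \<Rightarrow> real mat" where
  "lr_mat n K M = four_block_mat (0\<^sub>m n n) K M (0\<^sub>m n n)"

definition vec_span :: "nat \<Rightarrow> real vec set \<Rightarrow> real vec set" where
  "vec_span N S = LinearCombinations.module.span class_ring (module_vec TYPE(real) N) S"

definition sum_of_subspaces :: "nat \<Rightarrow> (nat \<Rightarrow> real vec set) \<Rightarrow> nat set \<Rightarrow> real vec set" where
  "sum_of_subspaces N W I = {finsum_vec TYPE(real) N w I | w. w \<in> Pi I W}"

definition direct_sum_decomposition ::
    "nat \<Rightarrow> (nat \<Rightarrow> real vec set) \<Rightarrow> nat set \<Rightarrow> bool" where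
  "direct_sum_decomposition N W I \<longleftrightarrow>
     finite I \<and>
     (\<forall>i \<in> I. VectorSpace.subspace class_ring (W i) (module_vec TYPE(real) N)) \<and>
     (\<forall>v \<in> carrier_vec N. \<exists>!w. w \<in> Pi\<^sub>E I W \<and> v = finsum_vec TYPE(real) N w I)"

definition invariant_under :: "real mat \<Rightarrow> real vec set \<Rightarrow> bool" where
  "invariant_under A W \<longleftrightarrow> (\<forall>v \<in> W. A *\<^sub>v v \<in> W)"

text \<open>The vectors of \<open>\<real>\<^bsup>2n\<^esup>\<close> are \<open>y @\<^sub>v x\<close> with \<open>x\<close> and \<open>y\<close> of dimension \<open>n\<close>,
  so \<open>vec_first\<close> extracts \<open>y\<close> and \<open>vec_last\<close> extracts \<open>x\<close>.\<close>

definition biorth :: "nat \<Rightarrow> real vec \<Rightarrow> real vec \<Rightarrow> bool" where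
  "biorth n p q \<longleftrightarrow>
     vec_first p n \<bullet> vec_last q n = 0 \<and> vec_first q n \<bullet> vec_last p n = 0"

definition biorth_vec_subspace :: "nat \<Rightarrow> real vec \<Rightarrow> real vec set \<Rightarrow> bool" where
  "biorth_vec_subspace n p W \<longleftrightarrow> (\<forall>q \<in> W. biorth n p q)"

definition biorth_mat_subspace :: "nat \<Rightarrow> real mat \<Rightarrow> real vec set \<Rightarrow> bool" where
  "biorth_mat_subspace n A W \<longleftrightarrow> (\<forall>j < dim_col A. biorth_vec_subspace n (col A j) W)"

definition biorth_subspaces :: "nat \<Rightarrow> real vec set \<Rightarrow> real vec set \<Rightarrow> bool" where
  "biorth_subspaces n W W' \<longleftrightarrow> (\<forall>p \<in> W. \<forall>q \<in> W'. biorth n p q)"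

definition decomposition_form ::
    "nat \<Rightarrow> nat \<Rightarrow> real mat \<Rightarrow> (nat \<Rightarrow> real vec) \<Rightarrow> (nat \<Rightarrow> real vec) \<Rightarrow>
     (nat \<Rightarrow> real vec) \<Rightarrow> (nat \<Rightarrow> real vec) \<Rightarrow> (nat \<Rightarrow> real) \<Rightarrow> (nat \<Rightarrow> real vec set) \<Rightarrow> bool" where
  "decomposition_form n r H x0 y0 x y ev W \<longleftrightarrow>
     (\<forall>i \<in> {1..r}. x0 i \<in> carrier_vec n \<and> y0 i \<in> carrier_vec n) \<and>
     (\<forall>i \<in> {1..n - r}. x i \<in> carrier_vec n \<and> y i \<in> carrier_vec n) \<and>
     W 0 = vec_span (n + n)
       ((\<lambda>i. 0\<^sub>v n @\<^sub>v x0 i) ` {1..r} \<union> (\<lambda>i. y0 i @\<^sub>v 0\<^sub>v n) ` {1..r}) \<and>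
     (\<forall>i \<in> {1..n - r}. W i = vec_span (n + n) {0\<^sub>v n @\<^sub>v x i, y i @\<^sub>v 0\<^sub>v n}) \<and>
     (\<forall>i \<in> {1..r}. H *\<^sub>v (0\<^sub>v n @\<^sub>v x0 i) = 0\<^sub>v n @\<^sub>v 0\<^sub>v n \<and>
                   H *\<^sub>v (y0 i @\<^sub>v 0\<^sub>v n) = 0\<^sub>v n @\<^sub>v x0 i) \<and>
     (\<forall>i \<in> {1..n - r}. H *\<^sub>v (y i @\<^sub>v x i) = ev i \<cdot>\<^sub>v (y i @\<^sub>v x i) \<and>
                       H *\<^sub>v ((- y i) @\<^sub>v x i) = (- ev i) \<cdot>\<^sub>v ((- y i) @\<^sub>v x i)) \<and>
     (mat_of_cols n (map x0 [1..<Suc r] @ map x [1..<Suc (n - r)]))\<^sup>T *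
       mat_of_cols n (map y0 [1..<Suc r] @ map y [1..<Suc (n - r)]) = 1\<^sub>m n"

text \<open>Multiplicity is meant algebraically, as a root of the characteristic polynomial.\<close>

definition lists_positive_eigenvalues :: "real mat \<Rightarrow> (nat \<Rightarrow> real) \<Rightarrow> nat \<Rightarrow> bool" where
  "lists_positive_eigenvalues A ev m \<longleftrightarrow>
     (\<forall>i \<in> {1..m}. 0 < ev i) \<and>
     (\<forall>i \<in> {1..m}. \<forall>j \<in> {1..m}. i \<le> j \<longrightarrow> ev i \<le> ev j) \<and>
     (\<forall>t > 0. card {i \<in> {1..m}. ev i = t} = order t (char_poly A))"

definition is_minimum :: "'a :: order set \<Rightarrow> 'a \<Rightarrow> bool" where
  "is_minimum S m \<longleftrightarrow> m \<in> S \<and> (\<forall>s \<in> S. m \<le> s)"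

end

theory Submission
  imports Defs
begin

text \<open>
  Put the \<open>x\<close>-vectors and the \<open>y\<close>-vectors of the decomposition into square matrices \<open>X\<close> and
  \<open>Y\<close>. Since \<open>X\<^sup>T Y = I\<close>, every admissible pair is \<open>U = X A\<close>, \<open>V = Y B\<close> with \<open>A = Y\<^sup>T U\<close>,
  \<open>B = X\<^sup>T V\<close> and \<open>A\<^sup>T B = I\<close>, and biorthogonality annihilates the rows of \<open>A\<close> and \<open>B\<close> that
  belong to \<open>\<V>\<^sub>0, \<dots>, \<V>\<^sub>l\<close>. As \<open>K x\<^sub>i = \<lambda>\<^sub>i y\<^sub>i\<close> and \<open>M y\<^sub>i = \<lambda>\<^sub>i x\<^sub>i\<close>, half the trace becomes
  the sum over the remaining rows of \<open>\<lambda>\<^sub>i (\<parallel>row\<^sub>i A\<parallel>\<^sup>2 + \<parallel>row\<^sub>i B\<parallel>\<^sup>2) / 2\<close>. This is bounded from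
  below by induction on the number of columns: a simultaneous orthogonal transformation of
  the columns makes the first row of \<open>B\<close> vanish outside the last column. The last column then
  contributes at least the smallest weight by AM-GM, and the other columns remain dual to each
  other after the first row has been dropped, so they contribute the next weights.
\<close>

section \<open>A lower bound for weighted sums over dual families of columns\<close>

lemma exists_orthogonal_annihilating:
  fixes b :: "nat \<Rightarrow> real"
  obtains Q :: "nat \<Rightarrow> nat \<Rightarrow> real" where
    "\<And>i j. Q i j = Q j i"
    "\<And>i j. i \<le> k \<Longrightarrow> j \<le> k \<Longrightarrow> (\<Sum>c\<le>k. Q i c * Q c j) = (if i = j then 1 else 0)"
    "\<And>c. c < k \<Longrightarrow> (\<Sum>j\<le>k. b j * Q j c) = 0"
  \<comment> \<open>\<open>Q\<close> is the Householder reflection that maps \<open>b\<close> to a multiple of the last unit vector.\<close>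
proof (cases "\<forall>j<k. b j = 0")
  \<comment> \<open>In this case the reflection vector can be zero, so the identity is taken
    instead.\<close>
  case True
  show ?thesis
    by (rule that[of "\<lambda>i j. if i = j then 1 else 0"]) (use True in \<open>auto simp: if_distrib cong: if_cong\<close>)
next
  case False
  define S where "S = (\<Sum>j<k. (b j)\<^sup>2)"
  define s where "s = sqrt (S + (b k)\<^sup>2)"
  \<comment> \<open>\<open>s\<close> is the norm of \<open>b\<close>, and \<open>v\<close> is
    \<open>b\<close> minus \<open>s\<close> times the last unit vector. A nonzero entry of
    \<open>b\<close> before position \<open>k\<close> makes \<open>v\<close> nonzero.\<close>
  define v where "v = b(k := b k - s)"
  define nv where "nv = (\<Sum>j\<le>k. (v j)\<^sup>2)"
  have sum_split: "(\<Sum>j\<le>k. f j) = (\<Sum>j<k. f j) + f k" for f :: "nat \<Rightarrow> real"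
    by (simp flip: lessThan_Suc_atMost)
  from False obtain j where j: "j < k" "b j \<noteq> 0" by blast
  have "0 < S"
    unfolding S_def by (rule sum_pos2[of _ j]) (use j in auto)
  have ss: "s\<^sup>2 = S + (b k)\<^sup>2"
    unfolding s_def using \<open>0 < S\<close> by (simp add: add_nonneg_nonneg)
  have nv: "nv = S + (b k - s)\<^sup>2"
    unfolding nv_def sum_split S_def by (simp add: v_def)
  have "0 < nv"
    using \<open>0 < S\<close> nv by (simp add: add_pos_nonneg)
  \<comment> \<open>This is why reflecting along \<open>v\<close> sends \<open>b\<close> to
    \<open>b - v\<close>, whose entries before position \<open>k\<close> are zero.\<close>
  have bv: "(\<Sum>j\<le>k. b j * v j) = nv / 2"
  proof -
    have "(\<Sum>j\<le>k. b j * v j) = S + b k * (b k - s)"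
      unfolding sum_split S_def by (simp add: v_def power2_eq_square)
    also have "\<dots> = nv / 2"
      unfolding nv using ss by (simp add: power2_eq_square algebra_simps)
    finally show ?thesis .
  qed
  define Q where "Q = (\<lambda>i j. (if i = j then 1 else 0) - 2 / nv * v i * v j)"
  show ?thesis
  proof (rule that[of Q])
    show "Q i j = Q j i" for i j
      by (simp add: Q_def)
    show "(\<Sum>c\<le>k. Q i c * Q c j) = (if i = j then 1 else 0)" if "i \<le> k" "j \<le> k" for i j
    proof -
      have "(\<Sum>c\<le>k. Q i c * Q c j)
        = (\<Sum>c\<le>k. (if i = c then (if c = j then 1 else 0) else 0)
            - (if i = c then 2 / nv * v c * v j else 0)
            - (if c = j then 2 / nv * v i * v c else 0)
            + 4 / nv\<^sup>2 * v i * v j * (v c)\<^sup>2)"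
        by (rule sum.cong) (auto simp: Q_def algebra_simps power2_eq_square)
      also have "\<dots> = (if i = j then 1 else 0) - 2 / nv * v i * v j - 2 / nv * v i * v j
          + 4 / nv\<^sup>2 * v i * v j * nv"
        using that by (simp add: sum.distrib sum_subtractf nv_def sum_distrib_left)
      also have "\<dots> = (if i = j then 1 else 0)"
        using \<open>0 < nv\<close> by (simp add: power2_eq_square)
      finally show ?thesis .
    qed
    show "(\<Sum>j\<le>k. b j * Q j c) = 0" if "c < k" for c
    proof -
      have "(\<Sum>j\<le>k. b j * Q j c)
        = (\<Sum>j\<le>k. (if j = c then b j else 0) - 2 / nv * v c * (b j * v j))"
        by (rule sum.cong) (auto simp: Q_def algebra_simps)
      also have "\<dots> = b c - 2 / nv * v c * (nv / 2)"
        using that by (simp only: sum_subtractf bv sum_distrib_left[symmetric]) simp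
      also have "\<dots> = 0"
        using that \<open>0 < nv\<close> by (simp add: v_def)
      finally show ?thesis .
    qed
  qed
qed

text \<open>Each induction step removes one column and the row of smallest weight, so the first row
  \<open>m\<close> and both families must stay arbitrary. Only the mutual duality of
  \<open>a\<close> and \<open>b\<close> is assumed, because this is what survives the removal of a
  row.\<close>

lemma weighted_sum_ge:
  fixes a b :: "nat \<Rightarrow> nat \<Rightarrow> real" and lam :: "nat \<Rightarrow> real"
  assumes "\<And>i. i \<in> {m..<N} \<Longrightarrow> 0 \<le> lam i"
    and "\<And>i j. m \<le> i \<Longrightarrow> i \<le> j \<Longrightarrow> j < N \<Longrightarrow> lam i \<le> lam j"
    and "\<And>c d. c < k \<Longrightarrow> d < k \<Longrightarrow> (\<Sum>i=m..<N. a i c * b i d) = (if c = d then 1 else 0)"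
  shows "(\<Sum>i<k. lam (m + i)) \<le> (\<Sum>i=m..<N. lam i * (\<Sum>j<k. ((a i j)\<^sup>2 + (b i j)\<^sup>2) / 2))"
  using assms
proof (induction k arbitrary: m a b)
  case 0
  then show ?case by (simp add: sum_nonneg)
next
  case (Suc k)
  \<comment> \<open>With no rows left, the duality sum at \<open>c = d = 0\<close> would be 0
    instead of 1.\<close>
  have "m < N"
    using Suc.prems(3)[of 0 0] by (cases "m < N") auto
  obtain Q :: "nat \<Rightarrow> nat \<Rightarrow> real" where Q_sym: "\<And>i j. Q i j = Q j i"
    and Q_orth: "\<And>i j. i \<le> k \<Longrightarrow> j \<le> k \<Longrightarrow> (\<Sum>c\<le>k. Q i c * Q c j) = (if i = j then 1 else 0)"
    and Q_ann: "\<And>c. c < k \<Longrightarrow> (\<Sum>j\<le>k. b m j * Q j c) = 0"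
    using exists_orthogonal_annihilating by blast
  \<comment> \<open>The same \<open>Q\<close> acts on the columns of \<open>a\<close> and of
    \<open>b\<close>. Being symmetric and its own inverse, it preserves both the row norms and the
    duality.\<close>
  define rot where "rot f i c = (\<Sum>j\<le>k. f i j * Q j c)" for f :: "nat \<Rightarrow> nat \<Rightarrow> real" and i c
  have norm_rot: "(\<Sum>c\<le>k. (rot f i c)\<^sup>2) = (\<Sum>j\<le>k. (f i j)\<^sup>2)" for f i
  proof -
    have "(\<Sum>c\<le>k. (rot f i c)\<^sup>2) = (\<Sum>c\<le>k. \<Sum>j\<le>k. \<Sum>j'\<le>k. f i j * f i j' * (Q j c * Q c j'))"
      unfolding rot_def power2_eq_square sum_product by (simp add: Q_sym[of _ c for c] mult_ac)
    also have "\<dots> = (\<Sum>j\<le>k. \<Sum>j'\<le>k. f i j * f i j' * (\<Sum>c\<le>k. Q j c * Q c j'))"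
      unfolding sum_distrib_left
      by (subst sum.swap, rule sum.cong[OF refl], subst sum.swap, rule refl)
    also have "\<dots> = (\<Sum>j\<le>k. \<Sum>j'\<le>k. if j = j' then f i j * f i j' else 0)"
      by (intro sum.cong refl) (simp add: Q_orth)
    also have "\<dots> = (\<Sum>j\<le>k. (f i j)\<^sup>2)"
      by (simp add: power2_eq_square)
    finally show ?thesis .
  qed
  have orth_rot: "(\<Sum>i=m..<N. rot a i c * rot b i d) = (if c = d then 1 else 0)"
    if "c \<le> k" "d \<le> k" for c d
  proof -
    have "(\<Sum>i=m..<N. rot a i c * rot b i d)
      = (\<Sum>i=m..<N. \<Sum>j\<le>k. \<Sum>j'\<le>k. (a i j * b i j') * (Q j c * Q j' d))"
      unfolding rot_def sum_product by (simp add: mult_ac)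
    also have "\<dots> = (\<Sum>j\<le>k. \<Sum>j'\<le>k. (\<Sum>i=m..<N. a i j * b i j') * (Q j c * Q j' d))"
      unfolding sum_distrib_right
      by (subst sum.swap, rule sum.cong[OF refl], subst sum.swap, rule refl)
    also have "\<dots> = (\<Sum>j\<le>k. \<Sum>j'\<le>k. if j = j' then Q j c * Q j' d else 0)"
      by (intro sum.cong refl) (simp add: Suc.prems(3))
    also have "\<dots> = (\<Sum>j\<le>k. Q c j * Q j d)"
      by (simp add: Q_sym[of _ c])
    also have "\<dots> = (if c = d then 1 else 0)"
      using that by (rule Q_orth)
    finally show ?thesis .
  qed
  have tail: "(\<Sum>i<k. lam (Suc m + i))
    \<le> (\<Sum>i=Suc m..<N. lam i * (\<Sum>j<k. ((rot a i j)\<^sup>2 + (rot b i j)\<^sup>2) / 2))"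
  proof (rule Suc.IH)
    fix c d assume cd: "c < k" "d < k"
    have "rot b m d = 0"
      unfolding rot_def using Q_ann cd by simp
    then show "(\<Sum>i=Suc m..<N. rot a i c * rot b i d) = (if c = d then 1 else 0)"
      using orth_rot[of c d] cd \<open>m < N\<close> by (simp add: sum.atLeast_Suc_lessThan)
  qed (use Suc.prems in auto)
  \<comment> \<open>Duality of column \<open>k\<close> with itself writes 1 as a sum of products.
    AM-GM and the monotonicity of the weights bound each term.\<close>
  have "lam m = lam m * (\<Sum>i=m..<N. rot a i k * rot b i k)"
    by (simp add: orth_rot)
  also have "\<dots> \<le> (\<Sum>i=m..<N. lam i * (((rot a i k)\<^sup>2 + (rot b i k)\<^sup>2) / 2))"
    unfolding sum_distrib_left
  proof (rule sum_mono)
    fix i assume i: "i \<in> {m..<N}"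
    have "rot a i k * rot b i k \<le> ((rot a i k)\<^sup>2 + (rot b i k)\<^sup>2) / 2"
      using sum_squares_bound[of "rot a i k" "rot b i k"] by simp
    then have "lam m * (rot a i k * rot b i k) \<le> lam m * (((rot a i k)\<^sup>2 + (rot b i k)\<^sup>2) / 2)"
      using Suc.prems(1)[of m] \<open>m < N\<close> by (intro mult_left_mono) auto
    also have "\<dots> \<le> lam i * (((rot a i k)\<^sup>2 + (rot b i k)\<^sup>2) / 2)"
      using Suc.prems(2)[of m i] i by (intro mult_right_mono) auto
    finally show "lam m * (rot a i k * rot b i k) \<le> lam i * (((rot a i k)\<^sup>2 + (rot b i k)\<^sup>2) / 2)" .
  qed
  finally have head: "lam m \<le> (\<Sum>i=m..<N. lam i * (((rot a i k)\<^sup>2 + (rot b i k)\<^sup>2) / 2))" .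
  have "(\<Sum>i<Suc k. lam (m + i)) = lam m + (\<Sum>i<k. lam (Suc m + i))"
    by (simp add: sum.lessThan_Suc_shift del: sum.lessThan_Suc)
  also have "\<dots> \<le> (\<Sum>i=m..<N. lam i * (((rot a i k)\<^sup>2 + (rot b i k)\<^sup>2) / 2))
      + (\<Sum>i=m..<N. lam i * (\<Sum>j<k. ((rot a i j)\<^sup>2 + (rot b i j)\<^sup>2) / 2))"
  proof (rule add_mono[OF head])
    \<comment> \<open>Putting row \<open>m\<close> back into the tail can only enlarge the
      right-hand side.\<close>
    have "0 \<le> lam m * (\<Sum>j<k. ((rot a m j)\<^sup>2 + (rot b m j)\<^sup>2) / 2)"
      using Suc.prems(1)[of m] \<open>m < N\<close> by (intro mult_nonneg_nonneg sum_nonneg) auto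
    then show "(\<Sum>i<k. lam (Suc m + i))
      \<le> (\<Sum>i=m..<N. lam i * (\<Sum>j<k. ((rot a i j)\<^sup>2 + (rot b i j)\<^sup>2) / 2))"
      using tail \<open>m < N\<close> by (simp add: sum.atLeast_Suc_lessThan)
  qed
  also have "\<dots> = (\<Sum>i=m..<N. lam i * (((\<Sum>j\<le>k. (rot a i j)\<^sup>2) + (\<Sum>j\<le>k. (rot b i j)\<^sup>2)) / 2))"
    unfolding sum.distrib[symmetric]
    by (intro sum.cong refl)
      (simp add: sum.distrib sum_divide_distrib[symmetric] field_simps flip: lessThan_Suc_atMost)
  also have "\<dots> = (\<Sum>i=m..<N. lam i * (\<Sum>j<Suc k. ((a i j)\<^sup>2 + (b i j)\<^sup>2) / 2))"
    unfolding norm_rot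
    by (simp only: lessThan_Suc_atMost sum.distrib[symmetric] sum_divide_distrib[symmetric])
  finally show ?case .
qed

section \<open>Quadratic forms and scalar products in a pair of dual bases\<close>

lemma mat_mult_transpose_right_inverse:
  fixes X Y :: "real mat"
  assumes "X \<in> carrier_mat n n" "Y \<in> carrier_mat n n" "X * Y\<^sup>T = 1\<^sub>m n" "u \<in> carrier_vec n"
  shows "X *\<^sub>v (Y\<^sup>T *\<^sub>v u) = u"
  using assms assoc_mult_mat_vec[of X n n "Y\<^sup>T" n u] by simp

text \<open>Expand \<open>u\<close> in the columns of \<open>X\<close>, with coefficients
  \<open>col Y i \<bullet> u\<close>. Then \<open>A\<close> turns each \<open>col X i\<close> into a
  multiple of \<open>col Y i\<close>, and pairing with \<open>u\<close> reproduces the coefficient.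
  The relation \<open>eig\<close> is restricted to nonzero coefficients because the basis vectors
  from \<V>\<open>\<^sub>0\<close> need not satisfy it with the weights used later.\<close>

lemma quadratic_form_in_eigenbasis:
  fixes X Y A :: "real mat"
  assumes X: "X \<in> carrier_mat n n" and Y: "Y \<in> carrier_mat n n" and XY: "X * Y\<^sup>T = 1\<^sub>m n"
    and A: "A \<in> carrier_mat n n" and u: "u \<in> carrier_vec n"
    and eig: "\<And>i. i < n \<Longrightarrow> col Y i \<bullet> u \<noteq> 0 \<Longrightarrow> A *\<^sub>v col X i = e i \<cdot>\<^sub>v col Y i"
  shows "u \<bullet> (A *\<^sub>v u) = (\<Sum>i<n. e i * (col Y i \<bullet> u)\<^sup>2)"
proof -
  have c: "Y\<^sup>T *\<^sub>v u \<in> carrier_vec n"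
    using Y u by (intro mult_mat_vec_carrier) auto
  have "A *\<^sub>v u = (A * X) *\<^sub>v (Y\<^sup>T *\<^sub>v u)"
    using mat_mult_transpose_right_inverse[OF X Y XY u] assoc_mult_mat_vec[OF A X c] by simp
  then have "u \<bullet> (A *\<^sub>v u) = ((A * X)\<^sup>T *\<^sub>v u) \<bullet> (Y\<^sup>T *\<^sub>v u)"
    using transpose_vec_mult_scalar[OF _ c u, of "A * X"] A X by simp
  also have "\<dots> = (\<Sum>i<n. (col (A * X) i \<bullet> u) * (col Y i \<bullet> u))"
    using X Y A by (auto simp: scalar_prod_def[of "_ *\<^sub>v _"] lessThan_atLeast0 intro!: sum.cong)
  also have "\<dots> = (\<Sum>i<n. e i * (col Y i \<bullet> u)\<^sup>2)"
  proof (rule sum.cong[OF refl])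
    fix i assume i: "i \<in> {..<n}"
    have "col (A * X) i \<bullet> u = e i * (col Y i \<bullet> u)" if "col Y i \<bullet> u \<noteq> 0"
    proof -
      have "col (A * X) i = e i \<cdot>\<^sub>v col Y i"
        using col_mult2[OF A X, of i] eig[OF _ that] i by (simp only: lessThan_iff)
      then show ?thesis
        using Y u by simp
    qed
    then show "(col (A * X) i \<bullet> u) * (col Y i \<bullet> u) = e i * (col Y i \<bullet> u)\<^sup>2"
      by (cases "col Y i \<bullet> u = 0") (auto simp: power2_eq_square)
  qed
  finally show ?thesis .
qed

lemma scalar_prod_in_dual_bases:
  fixes X Y :: "real mat"
  assumes X: "X \<in> carrier_mat n n" and Y: "Y \<in> carrier_mat n n" and XY: "X * Y\<^sup>T = 1\<^sub>m n"
    and u: "u \<in> carrier_vec n" and v: "v \<in> carrier_vec n"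
  shows "(\<Sum>i<n. (col Y i \<bullet> u) * (col X i \<bullet> v)) = u \<bullet> v"
proof -
  have "Y\<^sup>T *\<^sub>v u \<in> carrier_vec n"
    using Y u by (intro mult_mat_vec_carrier) auto
  then have dual: "(X *\<^sub>v (Y\<^sup>T *\<^sub>v u)) \<bullet> v = (Y\<^sup>T *\<^sub>v u) \<bullet> (X\<^sup>T *\<^sub>v v)"
    using transpose_vec_mult_scalar[of "X\<^sup>T" n n v "Y\<^sup>T *\<^sub>v u"] X v by simp
  have "u \<bullet> v = (X *\<^sub>v (Y\<^sup>T *\<^sub>v u)) \<bullet> v"
    using mat_mult_transpose_right_inverse[OF X Y XY u] by simp
  also have "\<dots> = (Y\<^sup>T *\<^sub>v u) \<bullet> (X\<^sup>T *\<^sub>v v)"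
    by (fact dual)
  also have "\<dots> = (\<Sum>i<n. (col Y i \<bullet> u) * (col X i \<bullet> v))"
    using X Y by (auto simp: scalar_prod_def[of "_ *\<^sub>v _"] lessThan_atLeast0 intro!: sum.cong)
  finally show ?thesis by simp
qed

section \<open>Traces, block vectors and sums of subspaces\<close>

lemma mat_trace_congruence:
  assumes "A \<in> carrier_mat n n" "U \<in> carrier_mat n k"
  shows "mat_trace (U\<^sup>T * A * U) = (\<Sum>j<k. col U j \<bullet> (A *\<^sub>v col U j))"
proof -
  have "U\<^sup>T * A * U = U\<^sup>T * (A * U)"
    using assms by (simp add: assoc_mult_mat[of _ k n _ n _ k])
  then show ?thesis
    using assms by (auto simp: mat_trace_def mult_mat_vec_def intro!: sum.cong)
qed

lemma mat_trace_add:
  assumes "A \<in> carrier_mat k k" "B \<in> carrier_mat k k"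
  shows "mat_trace (A + B) = mat_trace A + mat_trace B"
  using assms by (simp add: mat_trace_def sum.distrib)

lemma lr_mat_mult_vec:
  assumes "K \<in> carrier_mat n n" "M \<in> carrier_mat n n" "x \<in> carrier_vec n" "y \<in> carrier_vec n"
  shows "lr_mat n K M *\<^sub>v (y @\<^sub>v x) = (K *\<^sub>v x) @\<^sub>v (M *\<^sub>v y)"
  unfolding lr_mat_def
  by (subst four_block_mat_mult_vec[of _ n n _ n _ n]) (use assms in auto)

lemma vec_first_last_append_vec:
  assumes "y \<in> carrier_vec n" "x \<in> carrier_vec n"
  shows "vec_first (y @\<^sub>v x) n = y" "vec_last (y @\<^sub>v x) n = x"
  using assms by (auto simp: vec_first_def vec_last_def)

lemma col_append_rows:
  assumes "A \<in> carrier_mat n k" "B \<in> carrier_mat m k" "j < k"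
  shows "col (A @\<^sub>r B) j = col A j @\<^sub>v col B j"
  using assms by (auto simp: append_rows_def)

lemma mem_vec_span:
  assumes "S \<subseteq> carrier_vec N" "v \<in> S"
  shows "v \<in> vec_span N S"
proof -
  interpret vec_space "TYPE(real)" N .
  show ?thesis
    unfolding vec_span_def using in_own_span[of S] assms by auto
qed

lemma direct_sum_decompositionD:
  assumes "direct_sum_decomposition N W I" "i \<in> I"
  shows "W i \<subseteq> carrier_vec N" "0\<^sub>v N \<in> W i"
proof -
  have "submodule class_ring (W i) (module_vec TYPE(real) N)"
    using assms by (simp add: direct_sum_decomposition_def VectorSpace.subspace_def)
  then show "W i \<subseteq> carrier_vec N" "0\<^sub>v N \<in> W i"
    by (auto simp: LinearCombinations.submodule_def module_vec_simps)
qed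

text \<open>Take \<open>q\<close> as the component at \<open>i\<close> and zero as every other
  component. This allows biorthogonality to a sum to be tested on generators of a single
  summand.\<close>

lemma mem_sum_of_subspaces:
  assumes "finite I" "i \<in> I" "q \<in> W i"
    and "\<And>j. j \<in> I \<Longrightarrow> W j \<subseteq> carrier_vec N" "\<And>j. j \<in> I \<Longrightarrow> 0\<^sub>v N \<in> W j"
  shows "q \<in> sum_of_subspaces N W I"
proof -
  have q: "q \<in> carrier_vec N"
    using assms(2-4) by blast
  define w where "w = (\<lambda>j. if j = i then q else 0\<^sub>v N)"
  have w: "w \<in> Pi I W" "w \<in> I \<rightarrow> carrier_vec N"
    using assms q by (auto simp: w_def)
  have "q = finsum_vec TYPE(real) N w I"
  proof (rule eq_vecI)
    have f: "finsum_vec TYPE(real) N w I \<in> carrier_vec N"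
      by (rule finsum_vec_closed[OF w(2)])
    then show "dim_vec q = dim_vec (finsum_vec TYPE(real) N w I)"
      using q by simp
    fix t assume "t < dim_vec (finsum_vec TYPE(real) N w I)"
    then have t: "t < N" using f by simp
    have "finsum_vec TYPE(real) N w I $ t = (\<Sum>j\<in>I. w j $ t)"
      by (rule index_finsum_vec[OF \<open>finite I\<close> t w(2)])
    also have "\<dots> = (\<Sum>j\<in>I. if j = i then q $ t else 0)"
      using t by (intro sum.cong) (auto simp: w_def)
    also have "\<dots> = q $ t"
      using assms by simp
    finally show "q $ t = finsum_vec TYPE(real) N w I $ t" by simp
  qed
  then show ?thesis
    using w(1) by (auto simp: sum_of_subspaces_def)
qed

text \<open>Both scalar products in \<open>biorth\<close> are linear in the second vector, so they
  split over the finite sum.\<close>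

lemma biorth_vec_sum_of_subspaces:
  assumes "finite I"
    and W: "\<And>i. i \<in> I \<Longrightarrow> W i \<subseteq> carrier_vec (n + n)"
    and p: "\<And>i. i \<in> I \<Longrightarrow> biorth_vec_subspace n p (W i)"
  shows "biorth_vec_subspace n p (sum_of_subspaces (n + n) W I)"
  unfolding biorth_vec_subspace_def
proof
  fix q assume "q \<in> sum_of_subspaces (n + n) W I"
  then obtain w where w: "w \<in> Pi I W" and q: "q = finsum_vec TYPE(real) (n + n) w I"
    by (auto simp: sum_of_subspaces_def)
  have wc: "w \<in> I \<rightarrow> carrier_vec (n + n)" using w W by blast
  have qc: "q \<in> carrier_vec (n + n)"
    unfolding q by (rule finsum_vec_closed[OF wc])
  have wd: "dim_vec (w i) = n + n" if "i \<in> I" for i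
    using wc that by (auto dest!: Pi_mem)
  have qt: "q $ t = (\<Sum>i\<in>I. w i $ t)" if "t < n + n" for t
    unfolding q by (rule index_finsum_vec[OF \<open>finite I\<close> that wc])
  have first: "vec_first q n \<bullet> u = (\<Sum>i\<in>I. vec_first (w i) n \<bullet> u)" if "u \<in> carrier_vec n" for u
  proof -
    have "vec_first q n \<bullet> u = (\<Sum>t<n. \<Sum>i\<in>I. w i $ t * u $ t)"
      using that by (simp add: scalar_prod_def vec_first_def qt sum_distrib_right lessThan_atLeast0)
    then show ?thesis
      using that by (subst (asm) sum.swap) (simp add: scalar_prod_def vec_first_def lessThan_atLeast0)
  qed
  have last: "u \<bullet> vec_last q n = (\<Sum>i\<in>I. u \<bullet> vec_last (w i) n)" if "u \<in> carrier_vec n" for u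
  proof -
    have "u \<bullet> vec_last q n = (\<Sum>t<n. \<Sum>i\<in>I. u $ t * w i $ (n + t))"
      using that qc by (simp add: scalar_prod_def vec_last_def qt sum_distrib_left lessThan_atLeast0)
    then show ?thesis
      using that wd by (subst (asm) sum.swap) (simp add: scalar_prod_def vec_last_def lessThan_atLeast0)
  qed
  have "biorth n p (w i)" if "i \<in> I" for i
    using p that w by (auto simp: biorth_vec_subspace_def)
  then show "biorth n p q"
    by (simp add: biorth_def first last)
qed

section \<open>Eigenvector pairs and dual bases supplied by the decomposition\<close>

lemma decomposition_eigenpairs:
  assumes K: "K \<in> carrier_mat n n" and M: "M \<in> carrier_mat n n"
    and form: "decomposition_form n r (lr_mat n K M) x0 y0 x y ev W" and i: "i \<in> {1..n - r}"
  shows "x i \<in> carrier_vec n" "y i \<in> carrier_vec n"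
    "K *\<^sub>v x i = ev i \<cdot>\<^sub>v y i" "M *\<^sub>v y i = ev i \<cdot>\<^sub>v x i"
proof -
  show xy: "x i \<in> carrier_vec n" "y i \<in> carrier_vec n"
    using form i by (auto simp: decomposition_form_def)
  have "lr_mat n K M *\<^sub>v (y i @\<^sub>v x i) = ev i \<cdot>\<^sub>v (y i @\<^sub>v x i)"
    using form i by (simp add: decomposition_form_def)
  also have "\<dots> = (ev i \<cdot>\<^sub>v y i) @\<^sub>v (ev i \<cdot>\<^sub>v x i)"
    using xy by (intro eq_vecI) auto
  finally have "(K *\<^sub>v x i) @\<^sub>v (M *\<^sub>v y i) = (ev i \<cdot>\<^sub>v y i) @\<^sub>v (ev i \<cdot>\<^sub>v x i)"
    using lr_mat_mult_vec[OF K M xy] by simp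
  moreover have "K *\<^sub>v x i \<in> carrier_vec n" "ev i \<cdot>\<^sub>v y i \<in> carrier_vec n"
    using K xy by (auto intro: mult_mat_vec_carrier)
  ultimately show "K *\<^sub>v x i = ev i \<cdot>\<^sub>v y i" "M *\<^sub>v y i = ev i \<cdot>\<^sub>v x i"
    by (auto simp: append_vec_eq)
qed

text \<open>The shape of both factors in the duality condition of \<open>decomposition_form\<close>.
  It is used for the \<open>x\<close>-families as well as the \<open>y\<close>-families.\<close>

definition basis_mat :: "nat \<Rightarrow> nat \<Rightarrow> (nat \<Rightarrow> real vec) \<Rightarrow> (nat \<Rightarrow> real vec) \<Rightarrow> real mat" where
  "basis_mat n r x0 x = mat_of_cols n (map x0 [1..<Suc r] @ map x [1..<Suc (n - r)])"

lemma basis_mat: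
  assumes "r \<le> n" "\<And>i. i \<in> {1..r} \<Longrightarrow> x0 i \<in> carrier_vec n" "\<And>i. i \<in> {1..n - r} \<Longrightarrow> x i \<in> carrier_vec n"
  shows "basis_mat n r x0 x \<in> carrier_mat n n"
    and "i < n \<Longrightarrow> col (basis_mat n r x0 x) i = (if i < r then x0 (Suc i) else x (Suc i - r))"
proof -
  show "basis_mat n r x0 x \<in> carrier_mat n n"
    using assms(1) by (auto simp: basis_mat_def simp del: upt_Suc)
  let ?xs = "map x0 [1..<Suc r] @ map x [1..<Suc (n - r)]"
  assume i: "i < n"
  have nth: "?xs ! i = (if i < r then x0 (Suc i) else x (Suc i - r))"
    using i assms(1) by (auto simp: nth_append Suc_diff_le simp del: upt_Suc)
  then have "?xs ! i \<in> carrier_vec n"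
    using i assms(2)[of "Suc i"] assms(3)[of "Suc i - r"]
    by (cases "i < r") (auto simp: not_less Suc_diff_le simp del: upt_Suc)
  with nth show "col (basis_mat n r x0 x) i = (if i < r then x0 (Suc i) else x (Suc i - r))"
    unfolding basis_mat_def using i assms(1) by (subst col_mat_of_cols) (auto simp del: upt_Suc)
qed

section \<open>The trace minimum under biorthogonality constraints\<close>

theorem theorem2p9:
  fixes n r k l :: nat
    and K M H :: "real mat"
    and x0 y0 x y :: "nat \<Rightarrow> real vec"
    and ev :: "nat \<Rightarrow> real"
    and W :: "nat \<Rightarrow> real vec set"
  assumes K: "pos_semidef_mat n K"
    and M: "pos_def_mat n M"
    and H: "H = lr_mat n K M"
    and kernel: "kernel_dim H = r" "r > 0"
    and direct_sum: "direct_sum_decomposition (n + n) W {0..n - r}"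
    and biorthogonal:
      "\<forall>i \<in> {0..n - r}. \<forall>j \<in> {0..n - r}. i \<noteq> j \<longrightarrow> biorth_subspaces n (W i) (W j)"
    and invariant: "\<forall>i \<in> {0..n - r}. invariant_under H (W i)"
    and form: "decomposition_form n r H x0 y0 x y ev W"
    and eigenvalues: "lists_positive_eigenvalues H ev (n - r)"
    and k: "k \<in> {1..n - r}"
    and l: "l \<in> {0..n - r - k}"
  shows "is_minimum
    {1 / 2 * mat_trace (U\<^sup>T * K * U + V\<^sup>T * M * V) | U V.
       U \<in> carrier_mat n k \<and> V \<in> carrier_mat n k \<and> U\<^sup>T * V = 1\<^sub>m k \<and>
       biorth_mat_subspace n (V @\<^sub>r U) (sum_of_subspaces (n + n) W {0..l})}
    (\<Sum>i = 1..k. ev (l + i))"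
proof -
  have Kc: "K \<in> carrier_mat n n" and Mc: "M \<in> carrier_mat n n"
    using K M by (auto simp: pos_semidef_mat_def pos_def_mat_def)
  have rn: "r + l + k \<le> n"
    using k l by auto
  have ev_pos: "0 < ev i" if "i \<in> {1..n - r}" for i
    using eigenvalues that by (simp add: lists_positive_eigenvalues_def)
  have ev_mono: "ev i \<le> ev j" if "1 \<le> i" "i \<le> j" "j \<le> n - r" for i j
    using eigenvalues that by (simp add: lists_positive_eigenvalues_def)
  note form' = form[unfolded decomposition_form_def]
  have xy0: "x0 i \<in> carrier_vec n" "y0 i \<in> carrier_vec n" if "i \<in> {1..r}" for i
    using form' that by blast+
  note pairs = decomposition_eigenpairs[OF Kc Mc form[unfolded H]]
  define X where "X = basis_mat n r x0 x"
  define Y where "Y = basis_mat n r y0 y"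
  have X: "X \<in> carrier_mat n n" and Y: "Y \<in> carrier_mat n n"
    unfolding X_def Y_def using rn xy0 pairs by (auto intro!: basis_mat)
  have colX: "col X i = (if i < r then x0 (Suc i) else x (Suc i - r))"
    and colY: "col Y i = (if i < r then y0 (Suc i) else y (Suc i - r))" if "i < n" for i
    unfolding X_def Y_def using rn xy0 pairs(1,2) that by (intro basis_mat(2); simp)+
  have dual: "X\<^sup>T * Y = 1\<^sub>m n"
    using form' by (simp add: X_def Y_def basis_mat_def)
  \<comment> \<open>For square matrices a one-sided inverse is two-sided. The reversed product, and
    its transpose below, allow arbitrary vectors to be expanded in the columns of \<open>Y\<close>
    and of \<open>X\<close>.\<close>
  then have YX: "Y * X\<^sup>T = 1\<^sub>m n"
    using mat_mult_left_right_inverse[of "X\<^sup>T" n Y] X Y by simp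
  have XY: "X * Y\<^sup>T = 1\<^sub>m n"
    using arg_cong[OF YX, of transpose_mat] X Y by (simp add: transpose_mult[of _ n n _ n])
  have col_dual: "col X i \<bullet> col Y j = (if i = j then 1 else 0)" if "i < n" "j < n" for i j
  proof -
    have "(X\<^sup>T * Y) $$ (i, j) = (1\<^sub>m n :: real mat) $$ (i, j)"
      by (simp only: dual)
    then show ?thesis
      using that X Y by simp
  qed
  have xy_dual: "x i \<bullet> y j = (if i = j then 1 else 0)" if "i \<in> {1..n - r}" "j \<in> {1..n - r}" for i j
  proof -
    obtain i' j' where "i = Suc i'" "j = Suc j'"
      using \<open>i \<in> {1..n - r}\<close> \<open>j \<in> {1..n - r}\<close> by (cases i; cases j) auto
    then show ?thesis
      using col_dual[of "r + i'" "r + j'"] that by (simp add: colX colY)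
  qed
  have W_carrier: "W i \<subseteq> carrier_vec (n + n)" and W_zero: "0\<^sub>v (n + n) \<in> W i" if "i \<le> n - r" for i
    using direct_sum_decompositionD[OF direct_sum, of i] that by auto
  have gen: "0\<^sub>v n @\<^sub>v col X i \<in> W (Suc i - r)" "col Y i @\<^sub>v 0\<^sub>v n \<in> W (Suc i - r)" if "r \<le> i" "i < n" for i
  proof -
    have idx: "Suc i - r \<in> {1..n - r}" using that by auto
    then have "W (Suc i - r) = vec_span (n + n) {0\<^sub>v n @\<^sub>v x (Suc i - r), y (Suc i - r) @\<^sub>v 0\<^sub>v n}"
      using form' by blast
    then show "0\<^sub>v n @\<^sub>v col X i \<in> W (Suc i - r)" "col Y i @\<^sub>v 0\<^sub>v n \<in> W (Suc i - r)"
      using that pairs(1,2)[OF idx] by (auto simp: colX colY intro!: mem_vec_span)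
  qed
  have gen0: "0\<^sub>v n @\<^sub>v col X i \<in> W 0" "col Y i @\<^sub>v 0\<^sub>v n \<in> W 0" if "i < r" for i
  proof -
    have W0: "W 0 = vec_span (n + n)
       ((\<lambda>i. 0\<^sub>v n @\<^sub>v x0 i) ` {1..r} \<union> (\<lambda>i. y0 i @\<^sub>v 0\<^sub>v n) ` {1..r})"
      using form' by blast
    have "i < n" using that rn by simp
    then show "0\<^sub>v n @\<^sub>v col X i \<in> W 0" "col Y i @\<^sub>v 0\<^sub>v n \<in> W 0"
      unfolding W0 using that xy0 by (auto simp: colX colY intro!: mem_vec_span)
  qed
  let ?S = "sum_of_subspaces (n + n) W {0..l}"
  have gen_S: "0\<^sub>v n @\<^sub>v col X i \<in> ?S" "col Y i @\<^sub>v 0\<^sub>v n \<in> ?S" if "i < r + l" for i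
  proof -
    \<comment> \<open>The number of the summand is \<open>Suc i - r\<close> throughout: truncated
      subtraction gives 0 when \<open>i < r\<close>.\<close>
    have "\<exists>t\<le>l. 0\<^sub>v n @\<^sub>v col X i \<in> W t \<and> col Y i @\<^sub>v 0\<^sub>v n \<in> W t"
      using gen[of i] gen0[of i] that rn
      by (cases "i < r") (auto intro!: exI[of _ "Suc i - r"])
    then obtain t where "t \<le> l" "0\<^sub>v n @\<^sub>v col X i \<in> W t" "col Y i @\<^sub>v 0\<^sub>v n \<in> W t"
      by blast
    moreover have "W j \<subseteq> carrier_vec (n + n)" "0\<^sub>v (n + n) \<in> W j" if "j \<in> {0..l}" for j
      using rn that by (intro W_carrier W_zero; simp)+
    ultimately show "0\<^sub>v n @\<^sub>v col X i \<in> ?S" "col Y i @\<^sub>v 0\<^sub>v n \<in> ?S"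
      by (intro mem_sum_of_subspaces[of _ t]; simp)+
  qed
  \<comment> \<open>Columns count from 0, eigenvalues from 1. For \<open>i < r\<close> the value is
    the arbitrary \<open>ev 0\<close>, which later meets only zero coefficients.\<close>
  define lam where "lam i = ev (Suc i - r)" for i
  have lam_sum: "(\<Sum>i = 1..k. ev (l + i)) = (\<Sum>i<k. lam (r + l + i))"
    unfolding lam_def by (rule sum.reindex_bij_witness[of _ Suc "\<lambda>i. i - 1"]) auto
  have objective: "mat_trace (U\<^sup>T * K * U + V\<^sup>T * M * V)
      = (\<Sum>j<k. col U j \<bullet> (K *\<^sub>v col U j) + col V j \<bullet> (M *\<^sub>v col V j))"
    if "U \<in> carrier_mat n k" "V \<in> carrier_mat n k" for U V
    unfolding sum.distrib mat_trace_congruence[OF Kc that(1), symmetric]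
      mat_trace_congruence[OF Mc that(2), symmetric]
    by (rule mat_trace_add) (use that in auto)

  have lower: "(\<Sum>i = 1..k. ev (l + i)) \<le> 1 / 2 * mat_trace (U\<^sup>T * K * U + V\<^sup>T * M * V)"
    if U: "U \<in> carrier_mat n k" and V: "V \<in> carrier_mat n k" and UV: "U\<^sup>T * V = 1\<^sub>m k"
      and biorth: "biorth_mat_subspace n (V @\<^sub>r U) ?S" for U V
  proof -
    have Uc: "col U j \<in> carrier_vec n" and Vc: "col V j \<in> carrier_vec n" for j
      using U V by (auto simp: col_def)
    define a where "a i j = col Y i \<bullet> col U j" for i j
    define b where "b i j = col X i \<bullet> col V j" for i j
    \<comment> \<open>Testing column \<open>j\<close> against the generator with lower block
      \<open>col X i\<close> gives the claim for \<open>b\<close>. The generator with upper block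
      \<open>col Y i\<close> gives it for \<open>a\<close>.\<close>
    have vanish: "a i j = 0" "b i j = 0" if "i < r + l" "j < k" for i j
    proof -
      have "dim_col (V @\<^sub>r U) = k"
        using V by (simp add: append_rows_def)
      then have "biorth n (col V j @\<^sub>v col U j) q" if "q \<in> ?S" for q
        using biorth that \<open>j < k\<close> col_append_rows[OF V U \<open>j < k\<close>]
        by (auto simp: biorth_mat_subspace_def biorth_vec_subspace_def)
      from this[OF gen_S(1)[OF \<open>i < r + l\<close>]] this[OF gen_S(2)[OF \<open>i < r + l\<close>]]
      show "a i j = 0" "b i j = 0"
        using X Y Uc[of j] Vc[of j] comm_scalar_prod[of "col X i" n "col V j"]
        by (auto simp: biorth_def vec_first_last_append_vec a_def b_def col_dim)
    qed
    have tail: "(\<Sum>i<n. f i) = (\<Sum>i=r+l..<n. f i)" if "\<And>i. i < r + l \<Longrightarrow> f i = 0" for f :: "nat \<Rightarrow> real"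
      using rn that by (intro sum.mono_neutral_right) auto
    have eigK: "K *\<^sub>v col X i = lam i \<cdot>\<^sub>v col Y i" and eigM: "M *\<^sub>v col Y i = lam i \<cdot>\<^sub>v col X i"
      if "r + l \<le> i" "i < n" for i
    proof -
      have "Suc i - r \<in> {1..n - r}" using that by auto
      from pairs(3,4)[OF this] show "K *\<^sub>v col X i = lam i \<cdot>\<^sub>v col Y i" "M *\<^sub>v col Y i = lam i \<cdot>\<^sub>v col X i"
        using that by (simp_all add: colX colY lam_def)
    qed
    have quadK: "col U j \<bullet> (K *\<^sub>v col U j) = (\<Sum>i=r+l..<n. lam i * (a i j)\<^sup>2)" if "j < k" for j
    proof -
      have "col U j \<bullet> (K *\<^sub>v col U j) = (\<Sum>i<n. lam i * (a i j)\<^sup>2)"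
        unfolding a_def
      proof (rule quadratic_form_in_eigenbasis[OF X Y XY Kc Uc])
        fix i assume "i < n" "col Y i \<bullet> col U j \<noteq> 0"
        then show "K *\<^sub>v col X i = lam i \<cdot>\<^sub>v col Y i"
          using vanish(1)[of i j] \<open>j < k\<close> by (intro eigK) (auto simp: a_def not_less[symmetric])
      qed
      then show ?thesis
        using tail vanish(1) that by simp
    qed
    have quadM: "col V j \<bullet> (M *\<^sub>v col V j) = (\<Sum>i=r+l..<n. lam i * (b i j)\<^sup>2)" if "j < k" for j
    proof -
      have "col V j \<bullet> (M *\<^sub>v col V j) = (\<Sum>i<n. lam i * (b i j)\<^sup>2)"
        unfolding b_def
      \<comment> \<open>\<open>M\<close> maps the \<open>y\<close>-vectors to multiples of the
        \<open>x\<close>-vectors, so the two bases exchange roles.\<close>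
      proof (rule quadratic_form_in_eigenbasis[OF Y X YX Mc Vc])
        fix i assume "i < n" "col X i \<bullet> col V j \<noteq> 0"
        then show "M *\<^sub>v col Y i = lam i \<cdot>\<^sub>v col X i"
          using vanish(2)[of i j] \<open>j < k\<close> by (intro eigM) (auto simp: b_def not_less[symmetric])
      qed
      then show ?thesis
        using tail vanish(2) that by simp
    qed
    have "(\<Sum>i<k. lam (r + l + i)) \<le> (\<Sum>i=r+l..<n. lam i * (\<Sum>j<k. ((a i j)\<^sup>2 + (b i j)\<^sup>2) / 2))"
    proof (rule weighted_sum_ge)
      show "0 \<le> lam i" if "i \<in> {r + l..<n}" for i
        unfolding lam_def by (intro less_imp_le ev_pos) (use that in auto)
      show "lam i \<le> lam j" if "r + l \<le> i" "i \<le> j" "j < n" for i j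
        unfolding lam_def using that by (intro ev_mono) auto
      fix c d assume cd: "c < k" "d < k"
      have "(\<Sum>i=r+l..<n. a i c * b i d) = (\<Sum>i<n. a i c * b i d)"
        using tail[of "\<lambda>i. a i c * b i d"] vanish(1) cd by simp
      also have "\<dots> = col U c \<bullet> col V d"
        unfolding a_def b_def by (rule scalar_prod_in_dual_bases[OF X Y XY Uc Vc])
      also have "\<dots> = (U\<^sup>T * V) $$ (c, d)"
        using U V cd by simp
      finally show "(\<Sum>i=r+l..<n. a i c * b i d) = (if c = d then 1 else 0)"
        using cd by (simp add: UV)
    qed
    also have "\<dots> = (\<Sum>j<k. \<Sum>i=r+l..<n. lam i * (((a i j)\<^sup>2 + (b i j)\<^sup>2) / 2))"
      unfolding sum_distrib_left by (rule sum.swap)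
    also have "\<dots> = (\<Sum>j<k. (col U j \<bullet> (K *\<^sub>v col U j) + col V j \<bullet> (M *\<^sub>v col V j)) / 2)"
    proof (rule sum.cong[OF refl])
      fix j assume "j \<in> {..<k}"
      then have j: "j < k" by simp
      show "(\<Sum>i=r+l..<n. lam i * (((a i j)\<^sup>2 + (b i j)\<^sup>2) / 2))
        = (col U j \<bullet> (K *\<^sub>v col U j) + col V j \<bullet> (M *\<^sub>v col V j)) / 2"
        unfolding quadK[OF j] quadM[OF j] sum.distrib[symmetric] sum_divide_distrib
        by (simp add: distrib_left)
    qed
    also have "\<dots> = 1 / 2 * mat_trace (U\<^sup>T * K * U + V\<^sup>T * M * V)"
      unfolding objective[OF U V] by (simp flip: sum_divide_distrib)
    finally show ?thesis
      unfolding lam_sum .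
  qed

  \<comment> \<open>The bound is attained at the eigenvector pairs numbered \<open>l + 1\<close> to
    \<open>l + k\<close>, the first \<open>k\<close> after the excluded subspaces.\<close>
  define U where "U = mat_of_cols n (map (\<lambda>j. x (l + j + 1)) [0..<k])"
  define V where "V = mat_of_cols n (map (\<lambda>j. y (l + j + 1)) [0..<k])"
  have U: "U \<in> carrier_mat n k" and V: "V \<in> carrier_mat n k"
    by (auto simp: U_def V_def)
  have idx: "l + j + 1 \<in> {1..n - r}" if "j < k" for j
    using that rn by auto
  have colU: "col U j = x (l + j + 1)" and colV: "col V j = y (l + j + 1)" if "j < k" for j
    unfolding U_def V_def using that pairs(1,2)[OF idx[OF that]] by (subst col_mat_of_cols; simp)+
  have UV: "U\<^sup>T * V = 1\<^sub>m k"
    using U V by (intro eq_matI) (auto simp: colU colV xy_dual idx[simplified])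
  have biorth: "biorth_mat_subspace n (V @\<^sub>r U) ?S"
    unfolding biorth_mat_subspace_def
  proof (intro allI impI)
    fix j assume "j < dim_col (V @\<^sub>r U)"
    then have j: "j < k"
      using V by (simp add: append_rows_def)
    note xyj = pairs(1,2)[OF idx[OF j]]
    have "biorth_vec_subspace n (y (l + j + 1) @\<^sub>v x (l + j + 1)) (W t)" if "t \<in> {0..l}" for t
      unfolding biorth_vec_subspace_def
    proof
      fix q assume q: "q \<in> W t"
      \<comment> \<open>The summands differ because \<open>t \<le> l\<close>. The column is the sum
        of the two generators of \<open>W (l + j + 1)\<close>, so biorthogonality of each to
        \<open>q\<close> suffices.\<close>
      have "biorth_subspaces n (W (l + j + 1)) (W t)"
        using biorthogonal idx[OF j] that rn by simp
      moreover have "0\<^sub>v n @\<^sub>v x (l + j + 1) \<in> W (l + j + 1)" "y (l + j + 1) @\<^sub>v 0\<^sub>v n \<in> W (l + j + 1)"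
        using gen[of "r + l + j"] j rn by (auto simp: colX colY)
      ultimately have "biorth n (0\<^sub>v n @\<^sub>v x (l + j + 1)) q" "biorth n (y (l + j + 1) @\<^sub>v 0\<^sub>v n) q"
        using q by (auto simp: biorth_subspaces_def)
      then show "biorth n (y (l + j + 1) @\<^sub>v x (l + j + 1)) q"
        using xyj by (simp add: biorth_def vec_first_last_append_vec)
    qed
    then show "biorth_vec_subspace n (col (V @\<^sub>r U) j) ?S"
      unfolding col_append_rows[OF V U j] colU[OF j] colV[OF j]
      by (intro biorth_vec_sum_of_subspaces W_carrier) (use rn in auto)
  qed
  have "mat_trace (U\<^sup>T * K * U + V\<^sup>T * M * V) = (\<Sum>j<k. 2 * ev (l + j + 1))"
    unfolding objective[OF U V]
  proof (rule sum.cong[OF refl])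
    fix j assume "j \<in> {..<k}"
    then have j: "j < k" by simp
    note xyj = pairs[OF idx[OF j]]
    \<comment> \<open>\<open>K\<close> and \<open>M\<close> exchange the two vectors of a pair up to
      the factor \<open>ev (l + j + 1)\<close>, so both quadratic forms reduce to these
      products.\<close>
    have "x (l + j + 1) \<bullet> y (l + j + 1) = 1" "y (l + j + 1) \<bullet> x (l + j + 1) = 1"
      using xy_dual[OF idx[OF j] idx[OF j]] comm_scalar_prod[OF xyj(1,2)] by auto
    then show "col U j \<bullet> (K *\<^sub>v col U j) + col V j \<bullet> (M *\<^sub>v col V j) = 2 * ev (l + j + 1)"
      using xyj by (simp add: colU[OF j] colV[OF j])
  qed
  also have "\<dots> = 2 * (\<Sum>i = 1..k. ev (l + i))"
    unfolding sum_distrib_left by (rule sum.reindex_bij_witness[of _ "\<lambda>i. i - 1" Suc]) auto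
  finally have "(\<Sum>i = 1..k. ev (l + i)) = 1 / 2 * mat_trace (U\<^sup>T * K * U + V\<^sup>T * M * V)"
    by simp
  then show ?thesis
    unfolding is_minimum_def using U V UV biorth lower by blast
qed

end
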